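(* (1) If $p>2$, then the integrand $B_p\colon\mathbb{R}^{2\times 2}\to\mathbb{R}$ is polyconvex nowhere, i.e. there is no $A\in\mathbb{R}^{2\times 2}$ at which $B_p$ is polyconvex. (2) If $p<2$, then $B_p^+\colon\mathbb{R}^{2\times 2}\to\mathbb{R}$ is not polyconvex at points where it does not vanish, i.e. it is not polyconvex at any $A\in\mathbb{R}^{2\times 2}$ with $B_p^+(A)\neq 0$.
   Context: $|A|=\max_{|\xi|=1}|A\xi|$ is the operator norm. For $n=2$, the Burkholder integrand is defined for $p\geq n/2=1$ by $$B_p(A)=\Big(\Big|1-\frac 2p\Big|\,|A|^2+\det A\Big)|A|^{p-2},\qquad B_p(0)=0,$$ and $B_p^+=\max\{0,B_p\}$. For $A\in\mathbb{R}^{2\times 2}$, $M(A)=(A,\det A)\in\mathbb{R}^{5}$ denotes the vector of all minors of $A$. A function $F\colon\mathbb{R}^{2\times2}\to\mathbb{R}$ is polyconvex at $A$ if there is a convex function $G\colon\mathbb{R}^{5}\to\mathbb{R}$ such that $F(A)=G(M(A))$ and $F\geq G\circ M$ on $\mathbb{R}^{2\times 2}$.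
   Formalization: In (2), "p<2" is read as 1<p<2: the endpoint p=1 is excluded because there B_1(A)=2|a| for A: z ↦ az+b z̄, which is nonnegative and convex, so B_1^+ is polyconvex everywhere although B_1^+(I)=2≠0. *)

theory Defs
  imports "HOL-Analysis.Analysis"
begin

definition burkholder :: "real \<Rightarrow> real^2^2 \<Rightarrow> real" where
  "burkholder p A =
    (if A = 0 then 0
     else (\<bar>1 - 2 / p\<bar> * (onorm ((*v) A))\<^sup>2 + det A) * onorm ((*v) A) powr (p - 2))"

(* For p = 1, writing A as the map z |-> a z + b cnj z on the complex plane gives
   onorm = |a| + |b| and det A = |a|^2 - |b|^2, so burkholder 1 A = 2 |a|, which is
   nonnegative and convex. This is why results on failure of polyconvexity below
   exponent 2 have to exclude the endpoint p = 1. *)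
definition burkholder_pos :: "real \<Rightarrow> real^2^2 \<Rightarrow> real" where
  "burkholder_pos p A = max 0 (burkholder p A)"

(* The vector of all minors; the 5-dimensional space (real^2^2) \<times> real plays the role of R^5. *)
definition minors :: "real^2^2 \<Rightarrow> (real^2^2) \<times> real" where
  "minors A = (A, det A)"

definition polyconvex_at :: "(real^2^2 \<Rightarrow> real) \<Rightarrow> real^2^2 \<Rightarrow> bool" where
  "polyconvex_at F A \<longleftrightarrow>
    (\<exists>G :: (real^2^2) \<times> real \<Rightarrow> real.
       convex_on UNIV G \<and> F A = G (minors A) \<and> (\<forall>X. F X \<ge> G (minors X)))"

end

theory Submission
  imports Defs "HOL-Real_Asymp.Real_Asymp"
begin

text \<open>
  Suppose \<open>G\<close> witnesses polyconvexity of \<open>F\<close> at \<open>A\<close>, and consider the convex function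
  \<open>h s = G (A, det A + s)\<close> of one real variable. If \<open>N\<close> is a linear isometry, then the midpoint
  of the minors of \<open>A + t N\<close> and \<open>A - t N\<close> is \<open>(A, det A + t\<^sup>2 det N)\<close>, so \<open>h (t\<^sup>2 det N)\<close> is
  at most the mean of \<open>F\<close> at these two points. For \<open>p > 2\<close> a reflection \<open>N\<close> yields
  \<open>h (- t\<^sup>2) \<le> - \<epsilon> t\<^sup>p\<close>, which no convex function on the line satisfies. For \<open>1 < p < 2\<close> a
  reflection yields \<open>h (- t\<^sup>2) \<le> 0\<close> for large \<open>t\<close> and the identity yields \<open>h (t\<^sup>2) = o (t\<^sup>2)\<close>;
  convexity then forces \<open>h 0 \<le> 0\<close>, although \<open>h 0 = F A > 0\<close>.
\<close>

section \<open>Operator norm and determinant along lines in isometry directions\<close>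

lemma onorm_isometry:
  fixes N :: "real^'n^'n"
  assumes "\<And>x. norm (N *v x) = norm x"
  shows "onorm ((*v) N) = 1"
proof (rule antisym)
  show "onorm ((*v) N) \<le> 1"
    by (rule onorm_le) (simp add: assms)
  show "1 \<le> onorm ((*v) N)"
    \<comment> \<open>Any unit vector attains the norm; \<open>undefined\<close> is just some
      index.\<close>
    using onorm[OF matrix_vector_mul_bounded_linear[of N], of "axis undefined 1"]
    by (simp add: assms norm_axis_1)
qed

lemma onorm_add_scaled_isometry:
  fixes A N :: "real^'n^'n"
  assumes "\<And>x. norm (N *v x) = norm x"
  shows "onorm ((*v) (A + s *\<^sub>R N)) \<le> onorm ((*v) A) + \<bar>s\<bar>"
    and "\<bar>s\<bar> - onorm ((*v) A) \<le> onorm ((*v) (A + s *\<^sub>R N))"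
proof -
  have sN: "onorm ((*v) (s *\<^sub>R N)) = \<bar>s\<bar>"
    using onorm_scaleR[OF matrix_vector_mul_bounded_linear, of s N]
    by (simp add: scaleR_matrix_vector_assoc onorm_isometry[OF assms])
  have add: "(*v) (A + s *\<^sub>R N) = (\<lambda>x. A *v x + (s *\<^sub>R N) *v x)"
    by (auto simp: matrix_vector_mult_add_rdistrib)
  show "onorm ((*v) (A + s *\<^sub>R N)) \<le> onorm ((*v) A) + \<bar>s\<bar>"
    using onorm_triangle[OF matrix_vector_mul_bounded_linear matrix_vector_mul_bounded_linear, of A "s *\<^sub>R N"]
    by (simp add: add sN)
  \<comment> \<open>Reverse triangle inequality: the multiple of \<open>N\<close> is the perturbed
    matrix minus \<open>A\<close>.\<close>
  have sub: "(*v) (s *\<^sub>R N) = (\<lambda>x. (A + s *\<^sub>R N) *v x + - (A *v x))"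
    by (auto simp: matrix_vector_mult_add_rdistrib)
  have "onorm ((*v) (s *\<^sub>R N)) \<le> onorm ((*v) (A + s *\<^sub>R N)) + onorm (\<lambda>x. - (A *v x))"
    unfolding sub by (intro onorm_triangle bounded_linear_minus matrix_vector_mul_bounded_linear)
  then show "\<bar>s\<bar> - onorm ((*v) A) \<le> onorm ((*v) (A + s *\<^sub>R N))"
    by (simp add: sN onorm_neg)
qed

text \<open>In dimension 2 the determinant is a quadratic form. The bracket is its polar form at
  \<open>A\<close> and \<open>N\<close>; only its being independent of \<open>s\<close> matters
  later.\<close>

lemma det_add_scaled_2:
  fixes A N :: "real^2^2"
  shows "det (A + s *\<^sub>R N) = det A + s * (det (A + N) - det A - det N) + s\<^sup>2 * det N"
  by (simp add: det_2 algebra_simps power2_eq_square)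

text \<open>Complex conjugation on the plane, the isometry along which the determinant falls
  quadratically.\<close>

definition reflection :: "real^2^2" where
  "reflection = vector [vector [1, 0], vector [0, -1]]"

lemma det_reflection: "det reflection = -1"
  by (simp add: reflection_def det_2)

lemma norm_reflection: "norm (reflection *v x) = norm x"
  by (simp add: reflection_def norm_vec_def L2_set_def sum_2 matrix_vector_mult_def)

section \<open>Growth of the integrands along these lines\<close>

text \<open>The power of the norm stays unestimated, since the useful bound for it depends on the
  signs of \<open>p - 2\<close> and of the first factor.\<close>

lemma burkholder_add_scaled_isometry_le:
  fixes A N :: "real^2^2"
  assumes "\<And>x. norm (N *v x) = norm x"
    and "onorm ((*v) A) < \<bar>s\<bar>"
  shows "burkholder p (A + s *\<^sub>R N) \<le>
    (\<bar>1 - 2 / p\<bar> * (onorm ((*v) A) + \<bar>s\<bar>)\<^sup>2 + det A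
      + \<bar>s\<bar> * \<bar>det (A + N) - det A - det N\<bar> + s\<^sup>2 * det N)
    * onorm ((*v) (A + s *\<^sub>R N)) powr (p - 2)"
proof -
  let ?X = "A + s *\<^sub>R N"
  have "0 < onorm ((*v) ?X)"
    using onorm_add_scaled_isometry(2)[OF assms(1), of s A] assms(2) by linarith
  moreover have "(*v) (0 :: real^2^2) = (\<lambda>_. 0)"
    by auto
  ultimately have "?X \<noteq> 0"
    by (auto simp: onorm_zero)
  have "(onorm ((*v) ?X))\<^sup>2 \<le> (onorm ((*v) A) + \<bar>s\<bar>)\<^sup>2"
    using onorm_add_scaled_isometry(1)[OF assms(1)] \<open>0 < onorm ((*v) ?X)\<close>
    by (intro power_mono) auto
  then have sq: "\<bar>1 - 2 / p\<bar> * (onorm ((*v) ?X))\<^sup>2 \<le> \<bar>1 - 2 / p\<bar> * (onorm ((*v) A) + \<bar>s\<bar>)\<^sup>2"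
    by (rule mult_left_mono) simp
  have "s * (det (A + N) - det A - det N) \<le> \<bar>s\<bar> * \<bar>det (A + N) - det A - det N\<bar>"
    by (metis abs_ge_self abs_mult)
  with sq have "\<bar>1 - 2 / p\<bar> * (onorm ((*v) ?X))\<^sup>2 + det ?X \<le> \<bar>1 - 2 / p\<bar> * (onorm ((*v) A) + \<bar>s\<bar>)\<^sup>2 + det A
      + \<bar>s\<bar> * \<bar>det (A + N) - det A - det N\<bar> + s\<^sup>2 * det N"
    by (subst det_add_scaled_2) linarith
  then show ?thesis
    using \<open>?X \<noteq> 0\<close> by (simp add: burkholder_def mult_right_mono)
qed

text \<open>The first factor has leading coefficient \<open>\<bar>1 - 2 / p\<bar> - 1\<close>, which
  is negative because \<open>p > 1\<close>. Quantifying over \<open>s\<close> covers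
  \<open>t\<close> and \<open>- t\<close> with one threshold.\<close>

lemma burkholder_reflection_le:
  fixes A :: "real^2^2"
  assumes "1 < p"
  shows "\<exists>\<epsilon>>0. \<forall>\<^sub>F t in at_top. \<forall>s. \<bar>s\<bar> = t \<longrightarrow>
    burkholder p (A + s *\<^sub>R reflection)
      \<le> - (\<epsilon> * t\<^sup>2) * onorm ((*v) (A + s *\<^sub>R reflection)) powr (p - 2)"
proof -
  define c where "c = \<bar>1 - 2 / p\<bar>"
  define \<alpha> where "\<alpha> = onorm ((*v) A)"
  define k where "k = \<bar>det (A + reflection) - det A - det reflection\<bar>"
  have "c < 1"
    using assms by (auto simp: c_def abs_less_iff field_simps)
  have "((\<lambda>t. (c * (\<alpha> + t)\<^sup>2 + det A + t * k - t\<^sup>2) / t\<^sup>2) \<longlongrightarrow> c - 1) at_top"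
    by real_asymp
  \<comment> \<open>Half of the negative limit \<open>c - 1\<close> leaves room for a strict bound
    and supplies the \<epsilon>.\<close>
  then have "\<forall>\<^sub>F t in at_top. (c * (\<alpha> + t)\<^sup>2 + det A + t * k - t\<^sup>2) / t\<^sup>2 < - ((1 - c) / 2)"
    by (rule order_tendstoD) (use \<open>c < 1\<close> in \<open>simp add: field_simps\<close>)
  then have "\<forall>\<^sub>F t in at_top. \<forall>s. \<bar>s\<bar> = t \<longrightarrow>
    burkholder p (A + s *\<^sub>R reflection)
      \<le> - ((1 - c) / 2 * t\<^sup>2) * onorm ((*v) (A + s *\<^sub>R reflection)) powr (p - 2)"
    using eventually_gt_at_top[of \<alpha>] eventually_gt_at_top[of 0]
  proof eventually_elim
    case (elim t)
    show ?case
    proof (intro allI impI)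
      fix s :: real assume "\<bar>s\<bar> = t"
      let ?r = "onorm ((*v) (A + s *\<^sub>R reflection)) powr (p - 2)"
      have "burkholder p (A + s *\<^sub>R reflection) \<le> (c * (\<alpha> + t)\<^sup>2 + det A + t * k - t\<^sup>2) * ?r"
        using burkholder_add_scaled_isometry_le[OF norm_reflection, of A s p] elim \<open>\<bar>s\<bar> = t\<close>
        by (auto simp: c_def \<alpha>_def k_def det_reflection)
      also have "\<dots> \<le> - ((1 - c) / 2 * t\<^sup>2) * ?r"
        using elim by (intro mult_right_mono) (auto simp: pos_divide_less_eq)
      finally show "burkholder p (A + s *\<^sub>R reflection) \<le> - ((1 - c) / 2 * t\<^sup>2) * ?r" .
    qed
  qed
  then show ?thesis
    using \<open>c < 1\<close> by (intro exI[of _ "(1 - c) / 2"]) auto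
qed

text \<open>The first factor grows at most quadratically, while the power of the norm tends to 0
  since its exponent is negative.\<close>

lemma burkholder_pos_identity_subquadratic:
  fixes A :: "real^2^2"
  assumes "p < 2" and "0 < e"
  shows "\<forall>\<^sub>F t in at_top. \<forall>s. \<bar>s\<bar> = t \<longrightarrow> burkholder_pos p (A + s *\<^sub>R mat 1) \<le> e * t\<^sup>2"
proof -
  define c where "c = \<bar>1 - 2 / p\<bar>"
  define \<alpha> where "\<alpha> = onorm ((*v) A)"
  define k where "k = \<bar>det (A + mat 1) - det A - det (mat 1 :: real^2^2)\<bar>"
  define q where "q t = c * (\<alpha> + t)\<^sup>2 + det A + t * k + t\<^sup>2" for t
  have "((\<lambda>t. q t / t\<^sup>2) \<longlongrightarrow> c + 1) at_top"
    unfolding q_def by real_asymp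
  moreover have "((\<lambda>t. (t - \<alpha>) powr (p - 2)) \<longlongrightarrow> 0) at_top"
    by (rule tendsto_neg_powr) (use \<open>p < 2\<close> in simp, real_asymp)
  ultimately have "((\<lambda>t. \<bar>q t / t\<^sup>2\<bar> * (t - \<alpha>) powr (p - 2)) \<longlongrightarrow> \<bar>c + 1\<bar> * 0) at_top"
    by (intro tendsto_mult tendsto_rabs)
  then have "\<forall>\<^sub>F t in at_top. \<bar>q t / t\<^sup>2\<bar> * (t - \<alpha>) powr (p - 2) < e"
    by (rule order_tendstoD) (simp add: \<open>0 < e\<close>)
  then show ?thesis
    using eventually_gt_at_top[of \<alpha>] eventually_gt_at_top[of 0]
  proof eventually_elim
    case (elim t)
    show ?case
    proof (intro allI impI)
      fix s :: real assume st: "\<bar>s\<bar> = t"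
      let ?n = "onorm ((*v) (A + s *\<^sub>R mat 1))"
      have iso: "norm ((mat 1 :: real^2^2) *v x) = norm x" for x
        by simp
      have "burkholder p (A + s *\<^sub>R mat 1) \<le> q t * ?n powr (p - 2)"
        using burkholder_add_scaled_isometry_le[OF iso, of A s p] elim st
        by (auto simp: q_def c_def \<alpha>_def k_def)
      \<comment> \<open>The absolute value makes the first factor nonnegative, so that the second
        may be enlarged; its base shrinks under a negative exponent.\<close>
      also have "\<dots> \<le> \<bar>q t\<bar> * (t - \<alpha>) powr (p - 2)"
      proof (intro mult_mono powr_mono2')
        show "t - \<alpha> \<le> ?n"
          using onorm_add_scaled_isometry(2)[OF iso, of s A] st by (simp add: \<alpha>_def)
      qed (use elim \<open>p < 2\<close> in auto)
      also have "\<dots> \<le> e * t\<^sup>2"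
        using elim by (simp add: abs_div field_simps)
      finally show "burkholder_pos p (A + s *\<^sub>R mat 1) \<le> e * t\<^sup>2"
        using \<open>0 < e\<close> by (simp add: burkholder_pos_def)
    qed
  qed
qed

section \<open>Convexity in the determinant coordinate\<close>

text \<open>The linear terms of the determinant cancel in the mean. For \<open>det N\<close> and
  \<open>t\<close> nonzero the midpoint is off the graph of \<open>det\<close>, so \<open>F\<close>
  controls \<open>G\<close> there too.\<close>

lemma convex_minors_le_mean:
  fixes A N :: "real^2^2"
  assumes "convex_on UNIV G" and "\<And>X. G (minors X) \<le> F X"
  shows "G (A, det A + t\<^sup>2 * det N) \<le> (F (A + t *\<^sub>R N) + F (A + (- t) *\<^sub>R N)) / 2"
proof -
  have "(A, det A + t\<^sup>2 * det N) = (1 - 1/2) *\<^sub>R minors (A + t *\<^sub>R N) + (1/2) *\<^sub>R minors (A + (- t) *\<^sub>R N)"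
    unfolding minors_def det_add_scaled_2
    by (simp add: scaleR_2 flip: scaleR_add_right) (simp add: field_simps)
  then have "G (A, det A + t\<^sup>2 * det N)
      \<le> (1 - 1/2) * G (minors (A + t *\<^sub>R N)) + (1/2) * G (minors (A + (- t) *\<^sub>R N))"
    using convex_onD[OF assms(1), of "1/2"] by auto
  also have "\<dots> \<le> (1 - 1/2) * F (A + t *\<^sub>R N) + (1/2) * F (A + (- t) *\<^sub>R N)"
    by (intro add_mono mult_left_mono assms) auto
  finally show ?thesis by (simp add: field_simps)
qed

text \<open>Denominators are cleared so that growth rates can be compared: \<open>u\<close> tends to
  infinity with \<open>v\<close> fixed for \<open>p > 2\<close>, and conversely for
  \<open>p < 2\<close>.\<close>

lemma convex_fibre_interpolation:
  fixes G :: "'a::real_vector \<times> real \<Rightarrow> real"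
  assumes "convex_on UNIV G" and "0 < u" and "0 < v"
  shows "(u + v) * G (A, d) \<le> v * G (A, d - u) + u * G (A, d + v)"
proof -
  define w where "w = u / (u + v)"
  have w: "w * (u + v) = u" "0 \<le> w" "w \<le> 1"
    using assms(2,3) by (auto simp: w_def)
  have "(1 - w) * (d - u) + w * (d + v) = d - u + w * (u + v)"
    by (simp add: algebra_simps)
  then have mix: "(1 - w) *\<^sub>R (A, d - u) + w *\<^sub>R (A, d + v) = (A, d)"
    by (simp add: w flip: scaleR_add_left)
  have "G (A, d) \<le> (1 - w) * G (A, d - u) + w * G (A, d + v)"
    using convex_onD[OF assms(1), of w "(A, d - u)" "(A, d + v)"] w unfolding mix by simp
  then have "(u + v) * G (A, d) \<le> (u + v) * ((1 - w) * G (A, d - u) + w * G (A, d + v))"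
    using assms(2,3) by (intro mult_left_mono) auto
  also have "\<dots> = (u + v - w * (u + v)) * G (A, d - u) + w * (u + v) * G (A, d + v)"
    by (simp add: algebra_simps)
  finally show ?thesis
    by (simp add: w)
qed

section \<open>The two ranges of the exponent\<close>

lemma not_polyconvex_at_burkholder:
  assumes "2 < p"
  shows "\<not> polyconvex_at (burkholder p) A"
proof
  assume "polyconvex_at (burkholder p) A"
  then obtain G :: "(real^2^2) \<times> real \<Rightarrow> real" where G: "convex_on UNIV G"
    and below: "\<And>X. G (minors X) \<le> burkholder p X"
    unfolding polyconvex_at_def by blast
  define d where "d = det A"
  define \<alpha> where "\<alpha> = onorm ((*v) A)"
  obtain \<epsilon> where "0 < \<epsilon>" and
    ev: "\<forall>\<^sub>F t in at_top. \<forall>s. \<bar>s\<bar> = t \<longrightarrow> burkholder p (A + s *\<^sub>R reflection)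
      \<le> - (\<epsilon> * t\<^sup>2) * onorm ((*v) (A + s *\<^sub>R reflection)) powr (p - 2)"
    using burkholder_reflection_le[of p A] assms by auto
  \<comment> \<open>Interpolation between \<open>d - t^2\<close> and \<open>d + 1\<close> gives
    \<open>- G (A, d - t^2) \<le> K * \<epsilon> * t^2\<close> for \<open>t > 1\<close>; the 2 comes
    from \<open>t^2 + 1 \<le> 2 * t^2\<close>.\<close>
  define K where "K = (\<bar>G (A, d)\<bar> * 2 + \<bar>G (A, d + 1)\<bar>) / \<epsilon>"
  have "filterlim (\<lambda>t. (t - \<alpha>) powr (p - 2)) at_top at_top"
    using assms by real_asymp
  then have "\<forall>\<^sub>F t in at_top. K < (t - \<alpha>) powr (p - 2)"
    by (auto simp: filterlim_at_top_dense)
  \<comment> \<open>One sufficiently large \<open>t\<close> is contradictory, which suffices as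
    \<open>at_top\<close> is a nontrivial filter.\<close>
  then have "\<forall>\<^sub>F t::real in at_top. False"
    using ev eventually_gt_at_top[of \<alpha>] eventually_gt_at_top[of 1]
  proof eventually_elim
    case (elim t)
    have bound: "burkholder p (A + s *\<^sub>R reflection) \<le> - (\<epsilon> * t\<^sup>2) * (t - \<alpha>) powr (p - 2)"
      if "\<bar>s\<bar> = t" for s
    proof -
      have "(t - \<alpha>) powr (p - 2) \<le> onorm ((*v) (A + s *\<^sub>R reflection)) powr (p - 2)"
        using onorm_add_scaled_isometry(2)[OF norm_reflection, of s A] elim assms that
        by (intro powr_mono2) (auto simp: \<alpha>_def)
      then have "\<epsilon> * t\<^sup>2 * (t - \<alpha>) powr (p - 2)
          \<le> \<epsilon> * t\<^sup>2 * onorm ((*v) (A + s *\<^sub>R reflection)) powr (p - 2)"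
        using \<open>0 < \<epsilon>\<close> by (intro mult_left_mono) auto
      moreover have "burkholder p (A + s *\<^sub>R reflection)
          \<le> - (\<epsilon> * t\<^sup>2) * onorm ((*v) (A + s *\<^sub>R reflection)) powr (p - 2)"
        using elim that by blast
      ultimately show ?thesis by simp
    qed
    have "G (A, d - t\<^sup>2) \<le> - (\<epsilon> * t\<^sup>2) * (t - \<alpha>) powr (p - 2)"
      using convex_minors_le_mean[OF G below, of A t reflection] bound[of t] bound[of "- t"] elim
      by (simp add: d_def det_reflection)
    moreover have "(t\<^sup>2 + 1) * G (A, d) \<le> G (A, d - t\<^sup>2) + t\<^sup>2 * G (A, d + 1)"
      using convex_fibre_interpolation[OF G, of "t\<^sup>2" 1 A d] elim by simp
    moreover have "K * (\<epsilon> * t\<^sup>2) < (t - \<alpha>) powr (p - 2) * (\<epsilon> * t\<^sup>2)"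
      using elim \<open>0 < \<epsilon>\<close> by (intro mult_strict_right_mono) auto
    moreover have "K * (\<epsilon> * t\<^sup>2) = t\<^sup>2 * \<bar>G (A, d)\<bar> * 2 + t\<^sup>2 * \<bar>G (A, d + 1)\<bar>"
      using \<open>0 < \<epsilon>\<close> by (simp add: K_def field_simps)
    moreover have "- ((t\<^sup>2 + 1) * G (A, d)) \<le> t\<^sup>2 * \<bar>G (A, d)\<bar> * 2"
    proof -
      have "(t\<^sup>2 + 1) * - G (A, d) \<le> (t\<^sup>2 + 1) * \<bar>G (A, d)\<bar>"
        by (rule mult_left_mono) auto
      also have "\<dots> \<le> (t\<^sup>2 + t\<^sup>2) * \<bar>G (A, d)\<bar>"
        using elim one_le_power[of t 2] by (intro mult_right_mono) auto
      finally show ?thesis by simp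
    qed
    moreover have "t\<^sup>2 * G (A, d + 1) \<le> t\<^sup>2 * \<bar>G (A, d + 1)\<bar>"
      by (intro mult_left_mono) auto
    ultimately show False by (simp add: mult.commute)
  qed
  then show False by simp
qed

lemma burkholder_pos_eq_0_if_polyconvex_at:
  assumes "1 < p" and "p < 2" and "polyconvex_at (burkholder_pos p) A"
  shows "burkholder_pos p A = 0"
proof -
  obtain G :: "(real^2^2) \<times> real \<Rightarrow> real" where G: "convex_on UNIV G"
    and at: "burkholder_pos p A = G (minors A)"
    and below: "\<And>X. G (minors X) \<le> burkholder_pos p X"
    using assms(3) unfolding polyconvex_at_def by blast
  define d where "d = det A"
  obtain \<epsilon> where "0 < \<epsilon>" and
    ev: "\<forall>\<^sub>F t in at_top. \<forall>s. \<bar>s\<bar> = t \<longrightarrow> burkholder p (A + s *\<^sub>R reflection)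
      \<le> - (\<epsilon> * t\<^sup>2) * onorm ((*v) (A + s *\<^sub>R reflection)) powr (p - 2)"
    using burkholder_reflection_le[OF assms(1)] by blast
  have "\<forall>\<^sub>F u in at_top. 0 < u \<and> G (A, d - u\<^sup>2) \<le> 0"
    using ev eventually_gt_at_top[of 0]
  proof eventually_elim
    case (elim u)
    have "burkholder_pos p (A + s *\<^sub>R reflection) = 0" if "\<bar>s\<bar> = u" for s
    proof -
      have "burkholder p (A + s *\<^sub>R reflection)
          \<le> - (\<epsilon> * u\<^sup>2) * onorm ((*v) (A + s *\<^sub>R reflection)) powr (p - 2)"
        using elim that by blast
      also have "\<dots> \<le> 0"
        using \<open>0 < \<epsilon>\<close> by simp
      finally show ?thesis
        by (simp add: burkholder_pos_def)
    qed
    from this[of u] this[of "- u"] show ?case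
      using convex_minors_le_mean[OF G below, of A u reflection] elim
      by (simp add: d_def det_reflection)
  qed
  \<comment> \<open>This \<open>u\<close> stays fixed while \<open>t\<close> tends to infinity
    below.\<close>
  then obtain u where u: "0 < u" "G (A, d - u\<^sup>2) \<le> 0"
    by (auto simp: eventually_at_top_linorder)
  have "G (A, d) \<le> 0 + e" if "0 < e" for e
  proof -
    \<comment> \<open>Interpolation weights \<open>G (A, d + t^2)\<close> by \<open>u^2\<close>,
      which this tolerance cancels.\<close>
    have eu: "0 < e / u\<^sup>2"
      using u that by simp
    \<comment> \<open>The inequality does not involve \<open>t\<close>; the filter only provides a
      large one.\<close>
    have "\<forall>\<^sub>F t::real in at_top. G (A, d) \<le> e"
      using burkholder_pos_identity_subquadratic[OF assms(2) eu, of A] eventually_gt_at_top[of 0]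
    proof eventually_elim
      case (elim t)
      have "G (A, d + t\<^sup>2)
          \<le> (burkholder_pos p (A + t *\<^sub>R mat 1) + burkholder_pos p (A + (- t) *\<^sub>R mat 1)) / 2"
        using convex_minors_le_mean[OF G below, of A t "mat 1"] by (simp add: d_def)
      also have "\<dots> \<le> (e / u\<^sup>2 * t\<^sup>2 + e / u\<^sup>2 * t\<^sup>2) / 2"
        using elim(2) by (intro divide_right_mono add_mono elim(1)[rule_format]) auto
      finally have "G (A, d + t\<^sup>2) \<le> e / u\<^sup>2 * t\<^sup>2"
        by simp
      then have "u\<^sup>2 * G (A, d + t\<^sup>2) \<le> t\<^sup>2 * e"
        using u by (simp add: field_simps)
      moreover have "t\<^sup>2 * G (A, d - u\<^sup>2) \<le> 0"
        using u(2) by (simp add: mult_nonneg_nonpos)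
      moreover have "(u\<^sup>2 + t\<^sup>2) * G (A, d) \<le> t\<^sup>2 * G (A, d - u\<^sup>2) + u\<^sup>2 * G (A, d + t\<^sup>2)"
        using u elim by (intro convex_fibre_interpolation[OF G]) auto
      moreover have "t\<^sup>2 * e \<le> (u\<^sup>2 + t\<^sup>2) * e"
        using that by (simp add: mult_right_mono)
      ultimately have "(u\<^sup>2 + t\<^sup>2) * G (A, d) \<le> (u\<^sup>2 + t\<^sup>2) * e"
        by linarith
      then show ?case
        using u by (simp add: mult_le_cancel_left add_pos_nonneg)
    qed
    then show ?thesis by simp
  qed
  then have "G (A, d) \<le> 0"
    by (rule field_le_epsilon)
  \<comment> \<open>The positive part is nonnegative, so the upper bound 0 is an equality.\<close>
  then show ?thesis
    using at by (simp add: minors_def d_def burkholder_pos_def)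
qed

theorem proposition4p6:
  fixes p :: real
  shows "(p > 2 \<longrightarrow> \<not> (\<exists>A. polyconvex_at (burkholder p) A)) \<and>
         (1 < p \<and> p < 2 \<longrightarrow>
           (\<forall>A. burkholder_pos p A \<noteq> 0 \<longrightarrow> \<not> polyconvex_at (burkholder_pos p) A))"
  using not_polyconvex_at_burkholder burkholder_pos_eq_0_if_polyconvex_at by blast

end
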